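(* Let $\alpha\in[0,1]$ be real. Let $G$ be an $r_1$-regular connected graph with $n$ vertices and $m$ edges, with adjacency eigenvalues $\lambda_1\le\lambda_2\le\cdots\le\lambda_n=r_1$, and let $H_1,H_2,\ldots,H_m$ be $m$ $r_2$-regular graphs with $q$ vertices each. Suppose that the eigenvalues of $A_\alpha(H_i)$ are $\mu_1^{(i)}\le\mu_2^{(i)}\le\cdots\le\mu_q^{(i)}=r_2$ for $i=1,2,\ldots,m$. For $j=1,\ldots,n$ set $b_j=2\alpha+r_2+\alpha r_1(q+1)+(1-\alpha)\lambda_j$ and $$\gamma_j,\bar\gamma_j=\frac{b_j\pm\sqrt{b_j^2-4\Big((2\alpha+r_2)\big(\alpha r_1(q+1)+(1-\alpha)\lambda_j\big)-q(1-\alpha)^2(r_1+\lambda_j)\Big)}}{2}.$$ Then the $A_\alpha$-spectrum of the generalized edge corona $G[H_i]_1^m$ consists of: $2\alpha+r_2$ repeated $m-n$ times; $\mu_k^{(i)}+2\alpha$, once for each $i=1,\ldots,m$ and each $k=1,\ldots,q-1$; and $\gamma_j$ and $\bar\gamma_j$, once each for $j=1,\ldots,n$. (Coinciding values have their multiplicities added.)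
   Context: All graphs are finite, simple and undirected. For a graph $G$ with adjacency matrix $A(G)$ and diagonal degree matrix $D(G)$, and real $\alpha\in[0,1]$, $A_\alpha(G)=\alpha D(G)+(1-\alpha)A(G)$; the $A_\alpha$-spectrum is the multiset of eigenvalues of $A_\alpha(G)$. For a graph $G$ with $m$ edges $e_1,\ldots,e_m$ and graphs $H_1,\ldots,H_m$, the generalized edge corona $G[H_i]_1^m$ is the graph obtained by taking one copy of each of $G,H_1,\ldots,H_m$ (pairwise disjoint) and joining both end-vertices of the $i$th edge $e_i$ of $G$ to every vertex of $H_i$, for $1\le i\le m$. If $m-n<0$ (for connected regular $G$ this happens only for $G=K_1$ or $G=K_2$, when $m-n=-1$), "repeated $m-n$ times" means that the multiplicity of $2\alpha+r_2$ contributed by the other listed values is decreased by $n-m$. *)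

theory Defs
  imports
    "Jordan_Normal_Form.Char_Poly"
    "Graph_Theory.Pair_Digraph"
    "Graph_Theory.Digraph_Component"
begin

text \<open>
  A finite simple undirected graph is a \<^locale>\<open>pair_graph\<close>: every undirected edge is
  represented by its two opposite arcs, so the degree of a vertex is its out-degree.
\<close>

definition undirected_edges :: "'a pair_pre_digraph \<Rightarrow> 'a set set" where
  "undirected_edges G = {{u, v} |u v. (u, v) \<in> parcs G}"

definition regular_graph :: "nat \<Rightarrow> 'a pair_pre_digraph \<Rightarrow> bool" where
  "regular_graph r G \<longleftrightarrow> (\<forall>v \<in> pverts G. out_degree (with_proj G) v = r)"

text \<open>The list \<open>vs\<close> enumerates the vertices and fixes the order of rows and columns.\<close>

definition adjacency_matrix :: "'a pair_pre_digraph \<Rightarrow> 'a list \<Rightarrow> real mat" where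
  "adjacency_matrix G vs = mat (length vs) (length vs)
     (\<lambda>(i, j). if (vs ! i, vs ! j) \<in> parcs G then 1 else 0)"

definition degree_matrix :: "'a pair_pre_digraph \<Rightarrow> 'a list \<Rightarrow> real mat" where
  "degree_matrix G vs = mat (length vs) (length vs)
     (\<lambda>(i, j). if i = j then real (out_degree (with_proj G) (vs ! i)) else 0)"

definition A_alpha_matrix :: "real \<Rightarrow> 'a pair_pre_digraph \<Rightarrow> 'a list \<Rightarrow> real mat" where
  "A_alpha_matrix \<alpha> G vs =
     \<alpha> \<cdot>\<^sub>m degree_matrix G vs + (1 - \<alpha>) \<cdot>\<^sub>m adjacency_matrix G vs"

text \<open>
  Only real roots are collected; all matrices considered here are real symmetric, hence no
  eigenvalue is lost.
\<close>

definition eigenvalue_mset :: "real mat \<Rightarrow> real multiset" where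
  "eigenvalue_mset M = proots (char_poly M)"

text \<open>
  The choice of enumeration is immaterial, see \<open>adjacency_spectrum_eq\<close> and
  \<open>A_alpha_spectrum_eq\<close> below.
\<close>

definition vertex_enum :: "'a pair_pre_digraph \<Rightarrow> 'a list" where
  "vertex_enum G = (SOME vs. distinct vs \<and> set vs = pverts G)"

definition adjacency_spectrum :: "'a pair_pre_digraph \<Rightarrow> real multiset" where
  "adjacency_spectrum G = eigenvalue_mset (adjacency_matrix G (vertex_enum G))"

definition A_alpha_spectrum :: "real \<Rightarrow> 'a pair_pre_digraph \<Rightarrow> real multiset" where
  "A_alpha_spectrum \<alpha> G = eigenvalue_mset (A_alpha_matrix \<alpha> G (vertex_enum G))"

text \<open>
  The edges of \<open>G\<close> are listed as \<open>e 1, \<dots>, e m\<close>. The vertex \<open>x\<close> of \<open>H i\<close> becomes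
  \<open>Inr (i, x)\<close>, which makes the copies pairwise disjoint.
\<close>

definition edge_corona ::
  "'a pair_pre_digraph \<Rightarrow> nat \<Rightarrow> (nat \<Rightarrow> 'a set) \<Rightarrow> (nat \<Rightarrow> 'b pair_pre_digraph)
    \<Rightarrow> ('a + nat \<times> 'b) pair_pre_digraph" where
  "edge_corona G m e H =
    \<lparr> pverts = Inl ` pverts G \<union> {Inr (i, x) |i x. i \<in> {1..m} \<and> x \<in> pverts (H i)},
      parcs =
        {(Inl u, Inl v) |u v. (u, v) \<in> parcs G} \<union>
        {(Inr (i, x), Inr (i, y)) |i x y. i \<in> {1..m} \<and> (x, y) \<in> parcs (H i)} \<union>
        {(Inl u, Inr (i, x)) |u i x. i \<in> {1..m} \<and> u \<in> e i \<and> x \<in> pverts (H i)} \<union>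
        {(Inr (i, x), Inl u) |u i x. i \<in> {1..m} \<and> u \<in> e i \<and> x \<in> pverts (H i)} \<rparr>"

lemma pair_graph_edge_corona:
  assumes "pair_graph G" "\<And>i. i \<in> {1..m} \<Longrightarrow> pair_graph (H i)"
    and "\<And>i. i \<in> {1..m} \<Longrightarrow> e i \<in> undirected_edges G"
  shows "pair_graph (edge_corona G m e H)"
proof -
  have pg: "finite (pverts K)" "a \<in> parcs K \<Longrightarrow> fst a \<in> pverts K"
    "a \<in> parcs K \<Longrightarrow> snd a \<in> pverts K" "a \<in> parcs K \<Longrightarrow> fst a \<noteq> snd a" "sym (parcs K)"
    if "pair_graph K" for K :: "'c pair_pre_digraph" and a
  proof -
    interpret pair_graph K by fact
    show "finite (pverts K)" "sym (parcs K)"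
      using pair_finite_verts pair_sym_arcs by (simp_all add: symmetric_def)
    show "a \<in> parcs K \<Longrightarrow> fst a \<in> pverts K"
      "a \<in> parcs K \<Longrightarrow> snd a \<in> pverts K" "a \<in> parcs K \<Longrightarrow> fst a \<noteq> snd a"
      using arc_fst_in_verts arc_snd_in_verts pair_no_loops by blast+
  qed
  note G = pg[OF assms(1)] and H = pg[OF assms(2)]
  have e: "u \<in> pverts G" if i: "i \<in> {1..m}" and u: "u \<in> e i" for i u
  proof -
    obtain v w where "e i = {v, w}" "(v, w) \<in> parcs G"
      using assms(3)[OF i] unfolding undirected_edges_def by blast
    then show ?thesis using u G(2,3)[of "(v, w)"] by auto
  qed
  let ?C = "edge_corona G m e H"
  have V: "pverts ?C = Inl ` pverts G \<union> Inr ` (SIGMA i:{1..m}. pverts (H i))"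
    by (auto simp: edge_corona_def)
  have fV: "finite (pverts ?C)"
    unfolding V using H(1) G(1) by blast
  have sub: "parcs ?C \<subseteq> pverts ?C \<times> pverts ?C"
    unfolding edge_corona_def using H(2,3) G(2,3) e by fastforce
  have Hs: "(y, x) \<in> parcs (H i)" if "(x, y) \<in> parcs (H i)" "Suc 0 \<le> i" "i \<le> m" for i x y
    using symD[OF H(5) that(1)] that by simp
  have sym: "symmetric (with_proj ?C)"
    unfolding symmetric_def with_proj_simps edge_corona_def
    by (rule symI) (auto dest: symD[OF G(5)] Hs)
  have irr: "fst a \<noteq> snd a" if "a \<in> parcs ?C" for a
    using that H(4) G(4) unfolding edge_corona_def by fastforce
  have fA: "finite (parcs ?C)" using finite_subset[OF sub] fV by blast
  show ?thesis
    by unfold_locales (use sub fV fA sym irr in auto)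
qed

lemma char_poly_permute:
  assumes "p permutes {0..<n}"
  shows "char_poly (mat n n (\<lambda>(i, j). f (p i) (p j))) =
         char_poly (mat n n (\<lambda>(i, j). f i j :: real))"
proof -
  let ?C = "char_poly_matrix (mat n n (\<lambda>(i, j). f i j))"
  let ?R = "mat n n (\<lambda>(i, j). ?C $$ (p i, j))"
  have lt: "p i < n \<longleftrightarrow> i < n" for i using permutes_in_image[OF assms, of i] by simp
  have inj: "p i = p j \<longleftrightarrow> i = j" for i j using permutes_inj[OF assms] by (auto dest: injD)
  have C: "?C \<in> carrier_mat n n" by simp
  have "char_poly_matrix (mat n n (\<lambda>(i, j). f (p i) (p j))) =
      transpose_mat (mat n n (\<lambda>(i, j). transpose_mat ?R $$ (p i, j)))"
    by (rule eq_matI) (auto simp: char_poly_matrix_def lt inj)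
  then have "char_poly (mat n n (\<lambda>(i, j). f (p i) (p j))) =
      det (mat n n (\<lambda>(i, j). transpose_mat ?R $$ (p i, j)))"
    by (simp add: char_poly_def det_transpose[of _ n])
  also have "\<dots> = signof p * det (transpose_mat ?R)"
    by (rule det_permute_rows[OF _ assms]) simp
  also have "det (transpose_mat ?R) = signof p * det ?C"
    by (simp add: det_transpose[of _ n] det_permute_rows[OF C assms])
  also have "signof p * (signof p * det ?C) = det ?C"
    by (simp add: sign_def)
  finally show ?thesis by (simp add: char_poly_def)
qed

lemma char_poly_enum:
  assumes "distinct vs" "distinct ws" "set vs = set ws"
  shows "char_poly (mat (length vs) (length vs) (\<lambda>(i, j). f (vs ! i) (vs ! j))) =
         char_poly (mat (length ws) (length ws) (\<lambda>(i, j). f (ws ! i) (ws ! j) :: real))"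
proof -
  have "mset vs = mset ws" using assms by (simp add: set_eq_iff_mset_eq_distinct)
  then obtain p where p: "p permutes {..<length ws}" "permute_list p ws = vs"
    by (rule mset_eq_permutation)
  have len: "length vs = length ws" using p(2) by auto
  have "mat (length vs) (length vs) (\<lambda>(i, j). f (vs ! i) (vs ! j)) =
      mat (length ws) (length ws) (\<lambda>(i, j). f (ws ! p i) (ws ! p j))"
    unfolding len by (rule eq_matI) (auto simp: p(2)[symmetric] permute_list_nth[OF p(1)])
  then show ?thesis
    using char_poly_permute[of p "length ws" "\<lambda>i j. f (ws ! i) (ws ! j)"] p(1)
    by (simp add: lessThan_atLeast0)
qed

lemma vertex_enum:
  assumes "finite (pverts G)"
  shows "distinct (vertex_enum G)" "set (vertex_enum G) = pverts G"
  using someI_ex[of "\<lambda>vs. distinct vs \<and> set vs = pverts G"] finite_distinct_list[OF assms]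
  unfolding vertex_enum_def by auto

lemma adjacency_spectrum_eq:
  assumes "distinct vs" "set vs = pverts G"
  shows "adjacency_spectrum G = eigenvalue_mset (adjacency_matrix G vs)"
proof -
  have "finite (pverts G)" using assms(2) by (metis List.finite_set)
  note v = vertex_enum[OF this]
  show ?thesis
    unfolding adjacency_spectrum_def eigenvalue_mset_def adjacency_matrix_def
    using char_poly_enum[OF v(1) assms(1), of "\<lambda>x y. if (x, y) \<in> parcs G then 1 else 0"]
      v(2) assms(2) by simp
qed

lemma A_alpha_spectrum_eq:
  assumes "distinct vs" "set vs = pverts G"
  shows "A_alpha_spectrum \<alpha> G = eigenvalue_mset (A_alpha_matrix \<alpha> G vs)"
proof -
  have "finite (pverts G)" using assms(2) by (metis List.finite_set)
  note v = vertex_enum[OF this]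
  define f where "f x y = \<alpha> * (if x = y then real (out_degree (with_proj G) x) else 0) +
    (1 - \<alpha>) * (if (x, y) \<in> parcs G then 1 else 0)" for x y
  have A: "A_alpha_matrix \<alpha> G us = mat (length us) (length us) (\<lambda>(i, j). f (us ! i) (us ! j))"
    if "distinct us" for us
    by (rule eq_matI) (auto simp: A_alpha_matrix_def degree_matrix_def adjacency_matrix_def
      f_def nth_eq_iff_index_eq[OF that])
  show ?thesis
    unfolding A_alpha_spectrum_def eigenvalue_mset_def A[OF v(1)] A[OF assms(1)]
    using char_poly_enum[OF v(1) assms(1), of f] v(2) assms(2) by simp
qed

end

theory Submission
  imports Defs
begin

text \<open>
  Order the vertices of the corona with those of \<open>G\<close> first. Then \<open>t I - A\<^sub>\<alpha>\<close> is a two by two block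
  matrix; its lower right block \<open>N\<close> is block diagonal, one block per copy, and the off-diagonal blocks
  are \<open>- (1 - \<alpha>)\<close> times a vertex-edge incidence matrix \<open>C\<close> of \<open>G\<close> in which every edge column is
  repeated \<open>q\<close> times, and its transpose. Two facts drive the computation.

  \<^item> Every \<open>H i\<close> is regular, so vectors that are constant on each copy are eigenvectors of \<open>N\<close>:
    \<open>N C\<^sup>T = d C\<^sup>T\<close> with \<open>d = t - (2 \<alpha> + r\<^sub>2)\<close>. The first block can therefore be separated without
    inverting \<open>N\<close> (\<open>det_four_block_mat_eigen_column\<close>).
  \<^item> \<open>G\<close> is regular, so \<open>C C\<^sup>T = q (r\<^sub>1 I + A)\<close> (\<open>sum_inc_inc\<close>), and what remains of the first block
    is \<open>s I - s' A\<close> for scalars \<open>s\<close>, \<open>s'\<close>; its determinant is a product over the eigenvalues of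
    \<open>A\<close> (\<open>det_linear_combination_one\<close>).

  This gives the characteristic polynomial of the corona times \<open>d ^ n\<close> as a product of \<open>n\<close> quadratic
  polynomials in \<open>t\<close>, whose zeros are \<open>\<gamma>\<^sub>j\<close> and \<open>\<gamma>'\<^sub>j\<close>, and of the characteristic polynomials of
  the \<open>A\<^sub>\<alpha>\<close>-matrices of the copies, shifted by \<open>2 \<alpha>\<close> (\<open>poly_char_poly_corona\<close>). Each of
  the \<open>m\<close> copies contributes one factor \<open>d\<close> through its eigenvalue \<open>r\<^sub>2\<close>, and comparison with
  \<open>d ^ n\<close> leaves the multiplicity \<open>m - n\<close>. The quadratics have real zeros because the adjacency
  eigenvalues of an \<open>r\<^sub>1\<close>-regular graph are at least \<open>- r\<^sub>1\<close> (\<open>adjacency_eigenvalue_ge\<close>), which makes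
  the discriminant \<open>(2 \<alpha> + r\<^sub>2 - c\<^sub>j)\<^sup>2 + 4 q (1 - \<alpha>)\<^sup>2 (r\<^sub>1 + \<lambda>\<^sub>j)\<close>, where
  \<open>c\<^sub>j = \<alpha> r\<^sub>1 (q + 1) + (1 - \<alpha>) \<lambda>\<^sub>j\<close>, nonnegative.
\<close>

section \<open>Polynomials that split into linear factors\<close>

text \<open>
  As many roots as the degree means that dividing by a linear factor loses exactly one root and one
  degree, so the division can be continued down to the constant \<open>1\<close>.
\<close>

lemma monic_eq_prod_proots:
  fixes p :: "'a :: idom poly"
  assumes "monic p" "size (proots p) = degree p"
  shows "p = (\<Prod>a\<in>#proots p. [:- a, 1:])"
  using assms
proof (induction "degree p" arbitrary: p)
  case 0
  then have "p = 1" by (metis monic_degree_0)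
  then show ?case by simp
next
  case (Suc n)
  then have p0: "p \<noteq> 0" by auto
  have "proots p \<noteq> {#}" using Suc by auto
  then obtain a where "a \<in># proots p" by blast
  then have "poly p a = 0" using p0 by simp
  then obtain r where r: "p = [:- a, 1:] * r" by (auto simp: poly_eq_0_iff_dvd elim: dvdE)
  have r0: "r \<noteq> 0" using p0 r by auto
  have roots: "proots p = {#a#} + proots r"
    unfolding r by (subst proots_mult) (use r0 in auto)
  have deg: "degree p = Suc (degree r)"
    unfolding r by (subst degree_mult_eq) (use r0 in auto)
  have "monic r" using Suc.prems(1) unfolding r lead_coeff_mult by simp
  then have "r = (\<Prod>a\<in>#proots r. [:- a, 1:])"
    using Suc roots deg by (intro Suc.hyps(1)) auto
  then show ?case using r roots by simp
qed

section \<open>Determinants of block matrices\<close>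

text \<open>
  The determinant of the block matrix can be read off without inverting any block: its product
  with \<open>((d I, 0), (- B', I))\<close>, whose determinant is \<open>d\<close> to the size of the first block, is block
  upper triangular, because \<open>N B' = d B'\<close> cancels the lower left block. Dividing by \<open>d\<close> gives the
  Schur complement formula, but the version below also covers \<open>d = 0\<close> and singular \<open>N\<close>.
\<close>

lemma det_four_block_mat_eigen_column:
  fixes P :: "'a :: idom mat"
  assumes [simp]: "P \<in> carrier_mat n n" "B \<in> carrier_mat n k" "B' \<in> carrier_mat k n"
      "N \<in> carrier_mat k k"
    and eig: "N * B' = d \<cdot>\<^sub>m B'"
  shows "det (four_block_mat P B B' N) * d ^ n = det (d \<cdot>\<^sub>m P - B * B') * det N"
proof -
  note [simp] = carrier_matD[OF assms(2)] carrier_matD[OF assms(3)] carrier_matD[OF assms(4)]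
  let ?T = "four_block_mat (d \<cdot>\<^sub>m 1\<^sub>m n) (0\<^sub>m n k) (- B') (1\<^sub>m k)"
  have P: "P * (d \<cdot>\<^sub>m 1\<^sub>m n) + B * (- B') = d \<cdot>\<^sub>m P - B * B'"
    by (subst mult_smult_distrib[where n = n and nr = n and nc = n])
      (auto simp: right_mult_one_mat[of _ n n] intro!: eq_matI)
  have "B' * (d \<cdot>\<^sub>m 1\<^sub>m n) + N * (- B') = d \<cdot>\<^sub>m B' - N * B'"
    by (subst mult_smult_distrib[where n = n and nr = k and nc = n])
      (auto simp: right_mult_one_mat[of _ k n] intro!: eq_matI)
  then have B': "B' * (d \<cdot>\<^sub>m 1\<^sub>m n) + N * (- B') = 0\<^sub>m k n"
    unfolding eig by (auto intro!: eq_matI)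
  have "four_block_mat P B B' N * ?T = four_block_mat (d \<cdot>\<^sub>m P - B * B') B (0\<^sub>m k n) N"
    by (subst mult_four_block_mat[where ?nr1.0 = n and ?n1.0 = n and ?n2.0 = k and ?nr2.0 = k
          and ?nc1.0 = n and ?nc2.0 = k])
      (simp_all add: P B' left_add_zero_mat[of _ n k] left_add_zero_mat[of _ k k]
        right_mult_zero_mat[OF assms(1)] del: uminus_mult_right_mat)
  moreover have "det (four_block_mat P B B' N * ?T) = det (four_block_mat P B B' N) * det ?T"
    by (rule det_mult[where n = "n + k"]) auto
  moreover have "det ?T = d ^ n"
    by (subst det_four_block_mat_upper_right_zero[where n = n and m = k]) auto
  moreover have "det (four_block_mat (d \<cdot>\<^sub>m P - B * B') B (0\<^sub>m k n) N) =
      det (d \<cdot>\<^sub>m P - B * B') * det N"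
    by (rule det_four_block_mat_lower_left_zero) auto
  ultimately show ?thesis by simp
qed

text \<open>
  Pulling \<open>t\<close> out of \<open>s I - t A\<close> leaves the characteristic polynomial at \<open>s / t\<close>; for \<open>t = 0\<close>
  both sides are a power of \<open>s\<close>.
\<close>

lemma det_linear_combination_one:
  fixes A :: "'a :: field mat"
  assumes A: "A \<in> carrier_mat n n"
    and cp: "char_poly A = (\<Prod>j\<in>J. [:- l j, 1:])" and "finite J" "card J = n"
  shows "det (s \<cdot>\<^sub>m 1\<^sub>m n - t \<cdot>\<^sub>m A) = (\<Prod>j\<in>J. s - t * l j)"
proof (cases "t = 0")
  case True
  have "s \<cdot>\<^sub>m 1\<^sub>m n - 0 \<cdot>\<^sub>m A = s \<cdot>\<^sub>m 1\<^sub>m n" using A by (auto intro!: eq_matI)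
  then show ?thesis using True assms by simp
next
  case False
  have "s \<cdot>\<^sub>m 1\<^sub>m n - t \<cdot>\<^sub>m A = t \<cdot>\<^sub>m (- char_matrix A (s / t))"
    unfolding char_matrix_def using A False by (auto intro!: eq_matI simp: field_simps)
  then have "det (s \<cdot>\<^sub>m 1\<^sub>m n - t \<cdot>\<^sub>m A) = t ^ n * poly (char_poly A) (s / t)"
    using A by (simp add: char_poly_matrix[OF A] char_matrix_def)
  also have "\<dots> = (\<Prod>j\<in>J. t * (s / t - l j))"
    using assms by (simp add: cp poly_prod prod.distrib)
  finally show ?thesis using False by (simp add: right_diff_distrib)
qed

section \<open>Matrices indexed by lists\<close>

text \<open>
  Matrices whose rows and columns are labelled by lists of arbitrary objects: block decompositions
  become concatenations of lists, and products become sums over sets of labels.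
\<close>

definition list_mat :: "('a \<Rightarrow> 'b \<Rightarrow> 'c) \<Rightarrow> 'a list \<Rightarrow> 'b list \<Rightarrow> 'c mat" where
  "list_mat f xs ys = mat (length xs) (length ys) (\<lambda>(i, j). f (xs ! i) (ys ! j))"

lemma list_mat_carrier [simp]: "list_mat f xs ys \<in> carrier_mat (length xs) (length ys)"
  and dim_list_mat [simp]: "dim_row (list_mat f xs ys) = length xs"
    "dim_col (list_mat f xs ys) = length ys"
  and index_list_mat [simp]: "i < length xs \<Longrightarrow> j < length ys \<Longrightarrow>
    list_mat f xs ys $$ (i, j) = f (xs ! i) (ys ! j)"
  by (simp_all add: list_mat_def)

lemma list_mat_cong:
  assumes "\<And>x y. x \<in> set xs \<Longrightarrow> y \<in> set ys \<Longrightarrow> f x y = g x y"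
  shows "list_mat f xs ys = list_mat g xs ys"
  by (rule eq_matI) (use assms in auto)

lemma list_mat_map: "list_mat f (map g xs) (map h ys) = list_mat (\<lambda>x y. f (g x) (h y)) xs ys"
  by (rule eq_matI) auto

lemma list_mat_append:
  "list_mat f (xs @ xs') (ys @ ys') =
    four_block_mat (list_mat f xs ys) (list_mat f xs ys') (list_mat f xs' ys) (list_mat f xs' ys')"
  by (rule eq_matI) (auto simp: nth_append)

lemma list_mat_mult:
  assumes "distinct ys"
  shows "list_mat f xs ys * list_mat g ys zs =
    list_mat (\<lambda>x z. \<Sum>y\<in>set ys. f x y * g y z) xs zs"
  by (rule eq_matI) (auto simp: scalar_prod_def sum.distinct_set_conv_list[OF assms]
      sum_list_sum_nth lessThan_atLeast0)

lemma smult_list_mat: "c \<cdot>\<^sub>m list_mat f xs ys = list_mat (\<lambda>x y. c * f x y) xs ys"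
  by (rule eq_matI) auto

lemma minus_list_mat:
  "list_mat f xs ys - list_mat g xs ys = list_mat (\<lambda>x y. f x y - g x y) xs ys"
  by (rule eq_matI) auto

lemma one_mat_conv_list_mat:
  assumes "distinct xs"
  shows "1\<^sub>m (length xs) = list_mat (\<lambda>x y. of_bool (x = y)) xs xs"
  by (rule eq_matI) (auto simp: nth_eq_iff_index_eq[OF assms])

lemma poly_char_poly_list_mat:
  fixes f :: "'a \<Rightarrow> 'a \<Rightarrow> 'c :: field"
  assumes "distinct xs"
  shows "poly (char_poly (list_mat f xs xs)) t =
    det (list_mat (\<lambda>x y. t * of_bool (x = y) - f x y) xs xs)"
  by (subst char_poly_matrix[of _ "length xs"])
    (auto intro!: arg_cong[of _ _ det] eq_matI
      simp: char_matrix_def nth_eq_iff_index_eq[OF assms])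

lemma distinct_concat_map:
  assumes "distinct is" "\<And>i. i \<in> set is \<Longrightarrow> distinct (L i)"
    and "\<And>i j. i \<in> set is \<Longrightarrow> j \<in> set is \<Longrightarrow> i \<noteq> j \<Longrightarrow> set (L i) \<inter> set (L j) = {}"
  shows "distinct (concat (map L is))"
  using assms by (induction "is") fastforce+

lemma det_list_mat_concat:
  fixes f :: "'a \<Rightarrow> 'a \<Rightarrow> 'c :: idom"
  assumes "distinct is"
    and "\<And>i j x y. i \<in> set is \<Longrightarrow> j \<in> set is \<Longrightarrow> i \<noteq> j \<Longrightarrow> x \<in> set (L i) \<Longrightarrow> y \<in> set (L j) \<Longrightarrow>
      f x y = 0"
  shows "det (list_mat f (concat (map L is)) (concat (map L is))) =
    (\<Prod>i\<in>set is. det (list_mat f (L i) (L i)))"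
  using assms
proof (induction "is")
  case Nil
  show ?case by (simp add: det_dim_zero[of "list_mat f [] []"] carrier_matI)
next
  case (Cons i "is")
  let ?R = "concat (map L is)"
  have z: "list_mat f ?R (L i) = 0\<^sub>m (length ?R) (length (L i))"
  proof -
    have "list_mat f ?R (L i) = list_mat (\<lambda>x y. 0) ?R (L i)"
      by (rule list_mat_cong) (use Cons.prems in auto)
    then show ?thesis by (auto intro!: eq_matI)
  qed
  have "det (list_mat f (concat (map L (i # is))) (concat (map L (i # is)))) =
      det (list_mat f (L i) (L i)) * det (list_mat f ?R ?R)"
    unfolding list.map concat.simps list_mat_append
    by (rule det_four_block_mat_lower_left_zero[OF _ _ z]) auto
  also have "det (list_mat f ?R ?R) = (\<Prod>i\<in>set is. det (list_mat f (L i) (L i)))"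
    by (rule Cons.IH) (use Cons.prems in auto)
  finally show ?case using Cons.prems by simp
qed

section \<open>Adjacency and degrees\<close>

definition adj :: "'a pair_pre_digraph \<Rightarrow> 'a \<Rightarrow> 'a \<Rightarrow> real" where
  "adj K u v = of_bool ((u, v) \<in> parcs K)"

definition A_alpha_entry :: "real \<Rightarrow> 'a pair_pre_digraph \<Rightarrow> 'a \<Rightarrow> 'a \<Rightarrow> real" where
  "A_alpha_entry \<alpha> K u v =
     \<alpha> * real (out_degree (with_proj K) u) * of_bool (u = v) + (1 - \<alpha>) * adj K u v"

lemma adjacency_matrix_conv_list_mat: "adjacency_matrix K vs = list_mat (adj K) vs vs"
  by (rule eq_matI) (auto simp: adjacency_matrix_def adj_def)

lemma A_alpha_matrix_conv_list_mat:
  assumes "distinct vs"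
  shows "A_alpha_matrix \<alpha> K vs = list_mat (A_alpha_entry \<alpha> K) vs vs"
  by (rule eq_matI) (auto simp: A_alpha_matrix_def degree_matrix_def adjacency_matrix_def adj_def
      A_alpha_entry_def nth_eq_iff_index_eq[OF assms])

lemma pair_graph_arcs:
  assumes "pair_graph K"
  shows "finite (pverts K)" "(u, v) \<in> parcs K \<Longrightarrow> u \<in> pverts K"
    "(u, v) \<in> parcs K \<Longrightarrow> v \<in> pverts K" "(u, u) \<notin> parcs K"
    "(u, v) \<in> parcs K \<longleftrightarrow> (v, u) \<in> parcs K"
proof -
  interpret pair_graph K by fact
  show "finite (pverts K)" "(u, u) \<notin> parcs K" using pair_no_loops by (auto dest: pair_no_loops)
  show "(u, v) \<in> parcs K \<Longrightarrow> u \<in> pverts K" "(u, v) \<in> parcs K \<Longrightarrow> v \<in> pverts K"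
    using arc_fst_in_verts arc_snd_in_verts by fastforce+
  show "(u, v) \<in> parcs K \<longleftrightarrow> (v, u) \<in> parcs K"
    using pair_sym_arcs by (auto simp: symmetric_def dest: symD)
qed

lemma adj_self [simp]: "pair_graph K \<Longrightarrow> adj K u u = 0"
  by (simp add: adj_def pair_graph_arcs)

lemma sum_adj:
  assumes "pair_graph K"
  shows "(\<Sum>v\<in>pverts K. adj K u v) = real (out_degree (with_proj K) u)"
proof -
  note K = pair_graph_arcs[OF assms]
  have "(\<Sum>v\<in>pverts K. adj K u v) = real (card {v \<in> pverts K. (u, v) \<in> parcs K})"
    unfolding adj_def by (simp add: K(1) Collect_conj_eq Int_commute)
  also have "card {v \<in> pverts K. (u, v) \<in> parcs K} = card (Pair u ` {v \<in> pverts K. (u, v) \<in> parcs K})"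
    by (simp add: card_image inj_on_def)
  also have "Pair u ` {v \<in> pverts K. (u, v) \<in> parcs K} = out_arcs (with_proj K) u"
    using K(3) by (auto simp: out_arcs_def)
  finally show ?thesis by (simp add: out_degree_def)
qed

lemma sum_A_alpha_entry:
  assumes "pair_graph K" "u \<in> pverts K"
  shows "(\<Sum>v\<in>pverts K. A_alpha_entry \<alpha> K u v) = real (out_degree (with_proj K) u)"
proof -
  have "(\<Sum>v\<in>pverts K. A_alpha_entry \<alpha> K u v) =
      (\<Sum>v\<in>pverts K. if u = v then \<alpha> * real (out_degree (with_proj K) u) else 0)
      + (1 - \<alpha>) * (\<Sum>v\<in>pverts K. adj K u v)"
    unfolding A_alpha_entry_def sum.distrib sum_distrib_left
    by (intro arg_cong2[of _ _ _ _ "(+)"] sum.cong) auto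
  then show ?thesis
    using assms pair_graph_arcs(1)[OF assms(1)] by (simp add: sum_adj algebra_simps)
qed

text \<open>
  At a coordinate of largest modulus of an eigenvector, the eigenvalue equation bounds the
  eigenvalue by the row sum.
\<close>

lemma adjacency_eigenvalue_ge:
  assumes "pair_graph K" "regular_graph r K" "distinct vs" "set vs = pverts K"
    and root: "poly (char_poly (adjacency_matrix K vs)) l = 0"
  shows "- real r \<le> l"
proof -
  let ?A = "list_mat (adj K) vs vs" and ?n = "length vs"
  have "eigenvalue ?A l"
    using root by (subst eigenvalue_root_char_poly[of _ ?n]) (auto simp: adjacency_matrix_conv_list_mat)
  then obtain v where v: "v \<in> carrier_vec ?n" "v \<noteq> 0\<^sub>v ?n" "?A *\<^sub>v v = l \<cdot>\<^sub>v v"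
    unfolding eigenvalue_def eigenvector_def by auto
  define M where "M = Max ((\<lambda>i. \<bar>v $ i\<bar>) ` {..<?n})"
  obtain k where k: "k < ?n" "v $ k \<noteq> 0" using v(1,2) by (auto simp: vec_eq_iff)
  have ne: "(\<lambda>i. \<bar>v $ i\<bar>) ` {..<?n} \<noteq> {}" using k by auto
  obtain i where i: "i < ?n" "M = \<bar>v $ i\<bar>"
    using Max_in[OF _ ne] unfolding M_def by auto
  have le: "\<bar>v $ j\<bar> \<le> M" if "j < ?n" for j
    unfolding M_def using that by (intro Max_ge) auto
  have "M > 0" using le[OF k(1)] k(2) by auto
  have "l * v $ i = (?A *\<^sub>v v) $ i" using v i by simp
  also have "\<dots> = (\<Sum>j<?n. adj K (vs ! i) (vs ! j) * v $ j)"
    using v(1) i(1) by (simp add: scalar_prod_def lessThan_atLeast0)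
  finally have "\<bar>l\<bar> * M = \<bar>\<Sum>j<?n. adj K (vs ! i) (vs ! j) * v $ j\<bar>"
    unfolding i(2) by (metis abs_mult)
  also have "\<dots> \<le> (\<Sum>j<?n. \<bar>adj K (vs ! i) (vs ! j) * v $ j\<bar>)" by (rule sum_abs)
  also have "\<dots> \<le> (\<Sum>j<?n. adj K (vs ! i) (vs ! j) * M)"
    by (intro sum_mono) (auto simp: abs_mult adj_def le)
  also have "\<dots> = (\<Sum>w\<in>set vs. adj K (vs ! i) w) * M"
    by (simp add: sum.distinct_set_conv_list[OF assms(3)] sum_list_sum_nth lessThan_atLeast0
        sum_distrib_right)
  also have "\<dots> = real r * M"
    using assms(2,4) i(1) nth_mem[OF i(1)]
    by (simp add: sum_adj[OF assms(1)] regular_graph_def)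
  finally have "\<bar>l\<bar> \<le> real r" using \<open>M > 0\<close> by simp
  then show ?thesis by simp
qed


section \<open>Structure of the edge corona\<close>

locale regular_edge_corona =
  fixes G :: "'a pair_pre_digraph" and H :: "nat \<Rightarrow> 'b pair_pre_digraph"
    and e :: "nat \<Rightarrow> 'a set" and m q r\<^sub>1 r\<^sub>2 :: nat
  assumes pair_graph_G: "pair_graph G"
    and regular_G: "regular_graph r\<^sub>1 G"
    and bij_e: "bij_betw e {1..m} (undirected_edges G)"
    and pair_graph_H: "\<And>i. i \<in> {1..m} \<Longrightarrow> pair_graph (H i)"
    and regular_H: "\<And>i. i \<in> {1..m} \<Longrightarrow> regular_graph r\<^sub>2 (H i)"
    and card_H: "\<And>i. i \<in> {1..m} \<Longrightarrow> card (pverts (H i)) = q"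
begin

abbreviation corona :: "('a + nat \<times> 'b) pair_pre_digraph" where
  "corona \<equiv> edge_corona G m e H"

text \<open>
  The vertex-edge incidence matrix of \<open>G\<close>, with edges replaced by their indices under \<open>e\<close>.
\<close>

definition inc :: "'a \<Rightarrow> nat \<Rightarrow> real" where
  "inc u i = of_bool (u \<in> e i)"

lemmas arcs_G = pair_graph_arcs[OF pair_graph_G]

lemma edge_ends:
  assumes "i \<in> {1..m}"
  obtains u v where "e i = {u, v}" "(u, v) \<in> parcs G" "u \<noteq> v"
proof -
  have "e i \<in> undirected_edges G" using bij_e assms by (auto simp: bij_betw_def)
  then obtain u v where uv: "e i = {u, v}" "(u, v) \<in> parcs G"
    by (auto simp: undirected_edges_def)
  then show ?thesis using that arcs_G(4) by metis
qed

lemma pair_graph_corona: "pair_graph corona"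
  using bij_e by (intro pair_graph_edge_corona pair_graph_G pair_graph_H) (auto simp: bij_betw_def)

lemma sum_inc_vertices:
  assumes "i \<in> {1..m}"
  shows "(\<Sum>u\<in>pverts G. inc u i) = 2"
proof -
  obtain u v where uv: "e i = {u, v}" "(u, v) \<in> parcs G" "u \<noteq> v" using edge_ends[OF assms] .
  have "(\<Sum>w\<in>pverts G. inc w i) = (\<Sum>w\<in>{u, v}. inc w i)"
    using arcs_G(1) arcs_G(2,3)[OF uv(2)] by (intro sum.mono_neutral_right) (auto simp: inc_def uv(1))
  then show ?thesis using uv(3) by (simp add: inc_def uv(1))
qed

text \<open>
  The signless Laplacian identity \<open>B B\<^sup>T = D + A\<close>: two distinct vertices lie on at most one common
  edge, and a vertex lies on as many edges as its degree.
\<close>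

lemma sum_inc_inc:
  assumes u: "u \<in> pverts G" and v: "v \<in> pverts G"
  shows "(\<Sum>i=1..m. inc u i * inc v i) = real r\<^sub>1 * of_bool (u = v) + adj G u v"
proof -
  have fin: "finite (undirected_edges G)" using bij_betw_finite[OF bij_e] by simp
  have "(\<Sum>i=1..m. inc u i * inc v i) = (\<Sum>i=1..m. of_bool ({u, v} \<subseteq> e i))"
    by (intro sum.cong) (auto simp: inc_def)
  also have "\<dots> = (\<Sum>E\<in>undirected_edges G. of_bool ({u, v} \<subseteq> E))"
    by (rule sum.reindex_bij_betw[OF bij_e])
  also have "\<dots> = real (card {E \<in> undirected_edges G. {u, v} \<subseteq> E})"
    using fin by (simp add: Int_def)
  also have "\<dots> = real r\<^sub>1 * of_bool (u = v) + adj G u v"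
  proof (cases "u = v")
    case True
    let ?W = "{w \<in> pverts G. (u, w) \<in> parcs G}"
    have "{E \<in> undirected_edges G. {u, v} \<subseteq> E} = (\<lambda>w. {u, w}) ` ?W"
      using arcs_G(3,5) True unfolding undirected_edges_def
      by (auto simp: image_iff)
    moreover have "inj_on (\<lambda>w. {u, w}) ?W" by (auto simp: inj_on_def doubleton_eq_iff)
    ultimately have "card {E \<in> undirected_edges G. {u, v} \<subseteq> E} = card ?W"
      by (simp add: card_image)
    also have "real (card ?W) = (\<Sum>w\<in>pverts G. adj G u w)"
      using arcs_G(1) by (simp add: adj_def Int_def)
    also have "\<dots> = real r\<^sub>1"
      using sum_adj[OF pair_graph_G] regular_G u by (simp add: regular_graph_def)
    finally show ?thesis using True pair_graph_G by simp
  next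
    case False
    have "{E \<in> undirected_edges G. {u, v} \<subseteq> E} = (if (u, v) \<in> parcs G then {{u, v}} else {})"
      using False arcs_G(5) unfolding undirected_edges_def by auto
    then show ?thesis using False by (simp add: adj_def)
  qed
  finally show ?thesis .
qed

lemma sum_copies:
  fixes f :: "'a + nat \<times> 'b \<Rightarrow> real"
  shows "(\<Sum>w\<in>Inr ` (SIGMA i:{1..m}. pverts (H i)). f w) =
    (\<Sum>i=1..m. \<Sum>x\<in>pverts (H i). f (Inr (i, x)))"
proof -
  have "(\<Sum>w\<in>Inr ` (SIGMA i:{1..m}. pverts (H i)). f w) =
      (\<Sum>p\<in>(SIGMA i:{1..m}. pverts (H i)). f (Inr p))"
    by (subst sum.reindex) (auto simp: inj_on_def)
  also have "\<dots> = (\<Sum>i=1..m. \<Sum>x\<in>pverts (H i). f (Inr (i, x)))"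
    using pair_graph_arcs(1)[OF pair_graph_H] by (subst sum.Sigma) (auto simp: case_prod_unfold)
  finally show ?thesis .
qed

lemma pverts_corona:
  "pverts corona = Inl ` pverts G \<union> Inr ` (SIGMA i:{1..m}. pverts (H i))"
  by (auto simp: edge_corona_def)

lemma sum_corona:
  fixes f :: "'a + nat \<times> 'b \<Rightarrow> real"
  shows "(\<Sum>w\<in>pverts corona. f w) =
    (\<Sum>u\<in>pverts G. f (Inl u)) + (\<Sum>i=1..m. \<Sum>x\<in>pverts (H i). f (Inr (i, x)))"
proof -
  have "(\<Sum>w\<in>pverts corona. f w) =
      (\<Sum>w\<in>Inl ` pverts G. f w) + (\<Sum>w\<in>Inr ` (SIGMA i:{1..m}. pverts (H i)). f w)"
    unfolding pverts_corona using arcs_G(1) pair_graph_arcs(1)[OF pair_graph_H]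
    by (intro sum.union_disjoint finite_imageI finite_SigmaI) auto
  also have "(\<Sum>w\<in>Inl ` pverts G. f w) = (\<Sum>u\<in>pverts G. f (Inl u))"
    by (subst sum.reindex) (auto simp: inj_on_def)
  finally show ?thesis by (simp only: sum_copies)
qed

lemma adj_corona:
  "adj corona (Inl u) (Inl v) = adj G u v"
  "i \<in> {1..m} \<Longrightarrow> x \<in> pverts (H i) \<Longrightarrow> adj corona (Inl u) (Inr (i, x)) = inc u i"
  "i \<in> {1..m} \<Longrightarrow> x \<in> pverts (H i) \<Longrightarrow> adj corona (Inr (i, x)) (Inl u) = inc u i"
  "i \<in> {1..m} \<Longrightarrow> adj corona (Inr (i, x)) (Inr (j, y)) = of_bool (i = j) * adj (H i) x y"
  by (auto simp: adj_def inc_def edge_corona_def)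

lemma out_degree_corona:
  "u \<in> pverts G \<Longrightarrow> real (out_degree (with_proj corona) (Inl u)) = real r\<^sub>1 * (real q + 1)"
  "i \<in> {1..m} \<Longrightarrow> x \<in> pverts (H i) \<Longrightarrow>
    real (out_degree (with_proj corona) (Inr (i, x))) = real r\<^sub>2 + 2"
proof -
  assume u: "u \<in> pverts G"
  have "real (out_degree (with_proj corona) (Inl u)) = (\<Sum>w\<in>pverts corona. adj corona (Inl u) w)"
    by (simp only: sum_adj[OF pair_graph_corona])
  also have "\<dots> = (\<Sum>v\<in>pverts G. adj G u v) + (\<Sum>i=1..m. \<Sum>x\<in>pverts (H i). inc u i)"
    unfolding sum_corona by (intro arg_cong2[of _ _ _ _ "(+)"] sum.cong) (simp_all add: adj_corona)
  also have "(\<Sum>i=1..m. \<Sum>x\<in>pverts (H i). inc u i) = (\<Sum>i=1..m. real q * (inc u i * inc u i))"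
    by (intro sum.cong) (auto simp: card_H inc_def)
  also have "\<dots> = real q * real r\<^sub>1"
    unfolding sum_distrib_left[symmetric] sum_inc_inc[OF u u] using pair_graph_G by simp
  also have "(\<Sum>v\<in>pverts G. adj G u v) = real r\<^sub>1"
    using sum_adj[OF pair_graph_G] regular_G u by (simp add: regular_graph_def)
  finally show "real (out_degree (with_proj corona) (Inl u)) = real r\<^sub>1 * (real q + 1)"
    by (simp add: algebra_simps)
next
  assume i: "i \<in> {1..m}" and x: "x \<in> pverts (H i)"
  have "real (out_degree (with_proj corona) (Inr (i, x))) =
      (\<Sum>w\<in>pverts corona. adj corona (Inr (i, x)) w)"
    by (simp only: sum_adj[OF pair_graph_corona])
  also have "\<dots> = (\<Sum>u\<in>pverts G. inc u i)
      + (\<Sum>j=1..m. if i = j then \<Sum>y\<in>pverts (H i). adj (H i) x y else 0)"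
    unfolding sum_corona using i x
    by (intro arg_cong2[of _ _ _ _ "(+)"] sum.cong) (auto simp: adj_corona)
  also have "\<dots> = real r\<^sub>2 + 2"
    using i x regular_H[OF i] sum_adj[OF pair_graph_H[OF i]]
    by (simp add: sum_inc_vertices regular_graph_def)
  finally show "real (out_degree (with_proj corona) (Inr (i, x))) = real r\<^sub>2 + 2" .
qed

lemma A_alpha_entry_corona:
  "u \<in> pverts G \<Longrightarrow> A_alpha_entry \<alpha> corona (Inl u) (Inl v) =
    \<alpha> * real r\<^sub>1 * (real q + 1) * of_bool (u = v) + (1 - \<alpha>) * adj G u v"
  "i \<in> {1..m} \<Longrightarrow> x \<in> pverts (H i) \<Longrightarrow>
    A_alpha_entry \<alpha> corona (Inl u) (Inr (i, x)) = (1 - \<alpha>) * inc u i"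
  "i \<in> {1..m} \<Longrightarrow> x \<in> pverts (H i) \<Longrightarrow>
    A_alpha_entry \<alpha> corona (Inr (i, x)) (Inl u) = (1 - \<alpha>) * inc u i"
  "i \<in> {1..m} \<Longrightarrow> x \<in> pverts (H i) \<Longrightarrow> A_alpha_entry \<alpha> corona (Inr (i, x)) (Inr (j, y)) =
    of_bool (i = j) * (A_alpha_entry \<alpha> (H i) x y + 2 * \<alpha> * of_bool (x = y))"
  using regular_H[of i]
  by (auto simp: A_alpha_entry_def out_degree_corona adj_corona regular_graph_def algebra_simps)

section \<open>The characteristic polynomial of the edge corona\<close>

text \<open>
  The determinant lemma is applied to \<open>t I - A\<^sub>\<alpha>\<close> with the vertices of \<open>G\<close> as first block. The
  column of the lower left block that belongs to \<open>u\<close> is constant on every copy \<open>H i\<close>, and a constant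
  vector is an eigenvector of each diagonal block of the lower right block because \<open>H i\<close> is regular;
  so \<open>d = t - (2 \<alpha> + r\<^sub>2)\<close>. The remaining first block is a linear combination of the identity and
  the adjacency matrix of \<open>G\<close> by \<open>sum_inc_inc\<close>.
\<close>

lemma poly_char_poly_corona:
  fixes l :: "'c \<Rightarrow> real"
  assumes "distinct vs" "set vs = pverts corona"
    and gs: "distinct gs" "set gs = pverts G"
    and hs: "\<And>i. i \<in> {1..m} \<Longrightarrow> distinct (hs i)" "\<And>i. i \<in> {1..m} \<Longrightarrow> set (hs i) = pverts (H i)"
    and cp: "char_poly (adjacency_matrix G gs) = (\<Prod>j\<in>J. [:- l j, 1:])"
    and J: "finite J" "card J = card (pverts G)"
  shows "poly (char_poly (A_alpha_matrix \<alpha> corona vs)) t * (t - (2 * \<alpha> + real r\<^sub>2)) ^ card (pverts G) =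
    (\<Prod>j\<in>J. (t - (2 * \<alpha> + real r\<^sub>2)) * (t - (\<alpha> * real r\<^sub>1 * (real q + 1) + (1 - \<alpha>) * l j))
        - real q * (1 - \<alpha>)\<^sup>2 * (real r\<^sub>1 + l j)) *
    (\<Prod>i\<in>{1..m}. poly (char_poly (A_alpha_matrix \<alpha> (H i) (hs i))) (t - 2 * \<alpha>))"
proof -
  define d where "d = t - (2 * \<alpha> + real r\<^sub>2)"
  define g where "g w z = t * of_bool (w = z) - A_alpha_entry \<alpha> corona w z" for w z
  define L where "L i = map (\<lambda>x. Inr (i, x) :: 'a + nat \<times> 'b) (hs i)" for i
  define xs where "xs = map (Inl :: 'a \<Rightarrow> 'a + nat \<times> 'b) gs"
  define ys where "ys = concat (map L [1..<Suc m])"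
  let ?n = "card (pverts G)"
  have len_gs: "length gs = ?n" using gs distinct_card by metis
  have set_ys: "set ys = Inr ` (SIGMA i:{1..m}. pverts (H i))"
    unfolding ys_def L_def using hs(2) by (fastforce simp: image_iff)
  have ys: "distinct ys"
    unfolding ys_def using hs(1)
    by (intro distinct_concat_map) (auto simp: L_def distinct_map inj_on_def)
  have g_simps:
    "u \<in> pverts G \<Longrightarrow> g (Inl u) (Inl v) =
      (t - \<alpha> * real r\<^sub>1 * (real q + 1)) * of_bool (u = v) - (1 - \<alpha>) * adj G u v"
    "i \<in> {1..m} \<Longrightarrow> x \<in> pverts (H i) \<Longrightarrow> g (Inl u) (Inr (i, x)) = - (1 - \<alpha>) * inc u i"
    "i \<in> {1..m} \<Longrightarrow> x \<in> pverts (H i) \<Longrightarrow> g (Inr (i, x)) (Inl u) = - (1 - \<alpha>) * inc u i"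
    "i \<in> {1..m} \<Longrightarrow> x \<in> pverts (H i) \<Longrightarrow> g (Inr (i, x)) (Inr (j, y)) =
      of_bool (i = j) * ((t - 2 * \<alpha>) * of_bool (x = y) - A_alpha_entry \<alpha> (H i) x y)"
    for u v i j x y
    by (auto simp: g_def A_alpha_entry_corona algebra_simps)
  have "poly (char_poly (A_alpha_matrix \<alpha> corona vs)) t = det (list_mat g (xs @ ys) (xs @ ys))"
  proof -
    have dist: "distinct (xs @ ys)" using gs(1) ys set_ys by (auto simp: xs_def distinct_map)
    have "set vs = set (xs @ ys)" using assms(2) gs(2) set_ys by (simp add: xs_def pverts_corona)
    then have "char_poly (list_mat (A_alpha_entry \<alpha> corona) vs vs) =
        char_poly (list_mat (A_alpha_entry \<alpha> corona) (xs @ ys) (xs @ ys))"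
      unfolding list_mat_def by (rule char_poly_enum[OF assms(1) dist])
    then show ?thesis
      unfolding A_alpha_matrix_conv_list_mat[OF assms(1)]
      by (simp only: poly_char_poly_list_mat[OF dist] g_def[abs_def])
  qed
  also have "\<dots> * d ^ ?n = det (d \<cdot>\<^sub>m list_mat g xs xs - list_mat g xs ys * list_mat g ys xs)
      * det (list_mat g ys ys)"
    unfolding list_mat_append
  proof (rule det_four_block_mat_eigen_column[where k = "length ys"])
    have "(\<Sum>y\<in>set ys. g w y * g y z) = d * g w z" if wy: "w \<in> set ys" and zx: "z \<in> set xs" for w z
    proof -
      obtain i x where w: "w = Inr (i, x)" and i: "i \<in> {1..m}" and x: "x \<in> pverts (H i)"
        using wy set_ys by auto
      obtain u where z: "z = Inl u" and u: "u \<in> pverts G" using zx gs(2) by (auto simp: xs_def)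
      have "(\<Sum>y\<in>set ys. g w y * g y z) =
          (\<Sum>j=1..m. if i = j then \<Sum>y\<in>pverts (H i).
            ((if x = y then t - 2 * \<alpha> else 0) - A_alpha_entry \<alpha> (H i) x y) * (- (1 - \<alpha>) * inc u i) else 0)"
        unfolding set_ys sum_copies w z using i x
        by (intro sum.cong) (auto simp: g_simps intro!: sum.cong)
      also have "\<dots> = (t - 2 * \<alpha> - real r\<^sub>2) * (- (1 - \<alpha>) * inc u i)"
        using i x regular_H[OF i] pair_graph_arcs(1)[OF pair_graph_H[OF i]]
        by (simp add: sum_distrib_right[symmetric] sum_subtractf
            sum_A_alpha_entry[OF pair_graph_H[OF i]] regular_graph_def)
      finally show ?thesis using i x by (simp add: w z g_simps d_def)
    qed
    then show "list_mat g ys ys * list_mat g ys xs = d \<cdot>\<^sub>m list_mat g ys xs"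
      unfolding list_mat_mult[OF ys] smult_list_mat by (rule list_mat_cong)
  qed (auto intro!: carrier_matI simp: xs_def len_gs)
  also have "d \<cdot>\<^sub>m list_mat g xs xs - list_mat g xs ys * list_mat g ys xs =
      (d * (t - \<alpha> * real r\<^sub>1 * (real q + 1)) - real q * (1 - \<alpha>)\<^sup>2 * real r\<^sub>1) \<cdot>\<^sub>m 1\<^sub>m (length gs)
      - (d * (1 - \<alpha>) + real q * (1 - \<alpha>)\<^sup>2) \<cdot>\<^sub>m adjacency_matrix G gs"
    unfolding list_mat_mult[OF ys] smult_list_mat minus_list_mat xs_def list_mat_map
      one_mat_conv_list_mat[OF gs(1)] adjacency_matrix_conv_list_mat
  proof (rule list_mat_cong)
    fix u v assume "u \<in> set gs" "v \<in> set gs"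
    then have u: "u \<in> pverts G" and v: "v \<in> pverts G" using gs(2) by auto
    have "(\<Sum>y\<in>set ys. g (Inl u) y * g y (Inl v)) =
        (\<Sum>j=1..m. real q * (1 - \<alpha>)\<^sup>2 * (inc u j * inc v j))"
      unfolding set_ys sum_copies
      by (intro sum.cong) (auto simp: g_simps card_H power2_eq_square algebra_simps)
    also have "\<dots> = real q * (1 - \<alpha>)\<^sup>2 * (real r\<^sub>1 * of_bool (u = v) + adj G u v)"
      by (simp only: sum_distrib_left[symmetric] sum_inc_inc[OF u v])
    finally show "d * g (Inl u) (Inl v) - (\<Sum>y\<in>set ys. g (Inl u) y * g y (Inl v)) =
        (d * (t - \<alpha> * real r\<^sub>1 * (real q + 1)) - real q * (1 - \<alpha>)\<^sup>2 * real r\<^sub>1) * of_bool (u = v)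
        - (d * (1 - \<alpha>) + real q * (1 - \<alpha>)\<^sup>2) * adj G u v"
      using u by (simp add: g_simps algebra_simps)
  qed
  also have "det \<dots> = (\<Prod>j\<in>J. (d * (t - \<alpha> * real r\<^sub>1 * (real q + 1)) - real q * (1 - \<alpha>)\<^sup>2 * real r\<^sub>1)
      - (d * (1 - \<alpha>) + real q * (1 - \<alpha>)\<^sup>2) * l j)"
    by (rule det_linear_combination_one)
      (use cp J len_gs in \<open>auto simp: adjacency_matrix_conv_list_mat\<close>)
  also have "\<dots> = (\<Prod>j\<in>J. d * (t - (\<alpha> * real r\<^sub>1 * (real q + 1) + (1 - \<alpha>) * l j))
        - real q * (1 - \<alpha>)\<^sup>2 * (real r\<^sub>1 + l j))"
    by (intro prod.cong) (simp_all add: algebra_simps)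
  also have "det (list_mat g ys ys) = (\<Prod>i\<in>set [1..<Suc m]. det (list_mat g (L i) (L i)))"
    unfolding ys_def
    by (rule det_list_mat_concat) (use hs(2) in \<open>auto simp: L_def g_simps\<close>)
  also have "\<dots> = (\<Prod>i\<in>{1..m}. poly (char_poly (A_alpha_matrix \<alpha> (H i) (hs i))) (t - 2 * \<alpha>))"
  proof (rule prod.cong)
    fix i assume i: "i \<in> {1..m}"
    have "list_mat g (L i) (L i) =
        list_mat (\<lambda>x y. (t - 2 * \<alpha>) * of_bool (x = y) - A_alpha_entry \<alpha> (H i) x y) (hs i) (hs i)"
      unfolding L_def list_mat_map
      by (rule list_mat_cong) (use i hs(2)[OF i] in \<open>simp add: g_simps\<close>)
    then show "det (list_mat g (L i) (L i)) =
        poly (char_poly (A_alpha_matrix \<alpha> (H i) (hs i))) (t - 2 * \<alpha>)"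
      by (simp only: poly_char_poly_list_mat[OF hs(1)[OF i]]
          A_alpha_matrix_conv_list_mat[OF hs(1)[OF i]])
  qed auto
  finally show ?thesis unfolding d_def .
qed

end

section \<open>The spectrum of the edge corona\<close>

lemma proots_prod_linear:
  fixes f :: "'b \<Rightarrow> 'a :: idom"
  shows "proots (\<Prod>x\<in>A. [:- f x, 1:]) = (\<Sum>x\<in>A. {# f x #})"
  by (subst proots_prod) auto

text \<open>
  \<open>eigenvalue_mset\<close> collects real roots only; a family of full length certifies that these are
  all the roots.
\<close>

lemma char_poly_eq_prod_eigenvalues:
  assumes "M \<in> carrier_mat (card J) (card J)"
    and "eigenvalue_mset M = image_mset l (mset_set J)"
  shows "char_poly M = (\<Prod>j\<in>J. [:- l j, 1:])"
proof -
  have roots: "proots (char_poly M) = image_mset l (mset_set J)"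
    using assms(2) by (simp add: eigenvalue_mset_def)
  have "char_poly M = (\<Prod>a\<in>#proots (char_poly M). [:- a, 1:])"
    using degree_monic_char_poly[OF assms(1)] by (intro monic_eq_prod_proots) (simp_all add: roots)
  then show ?thesis unfolding roots by (simp add: prod_unfold_prod_mset image_mset.compositionality o_def)
qed

theorem corollary4p1:
  fixes \<alpha> :: real
    and G :: "'a pair_pre_digraph" and H :: "nat \<Rightarrow> 'b pair_pre_digraph"
    and e :: "nat \<Rightarrow> 'a set"
    and n m q r\<^sub>1 r\<^sub>2 :: nat
    and lam :: "nat \<Rightarrow> real" and \<mu> :: "nat \<Rightarrow> nat \<Rightarrow> real"
    and b \<gamma> \<gamma>' :: "nat \<Rightarrow> real"
  assumes "0 \<le> \<alpha>" and "\<alpha> \<le> 1"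
    and "pair_graph G" and "Digraph_Component.connected (with_proj G)"
    and "regular_graph r\<^sub>1 G"
    and "card (pverts G) = n"
    and "card (undirected_edges G) = m"
    and "bij_betw e {1..m} (undirected_edges G)"
    and "adjacency_spectrum G = image_mset lam (mset_set {1..n})"
    and "mono_on {1..n} lam" and "lam n = real r\<^sub>1"
    and "q \<ge> 1"
    and "\<And>i. i \<in> {1..m} \<Longrightarrow> pair_graph (H i)"
    and "\<And>i. i \<in> {1..m} \<Longrightarrow> regular_graph r\<^sub>2 (H i)"
    and "\<And>i. i \<in> {1..m} \<Longrightarrow> card (pverts (H i)) = q"
    and "\<And>i. i \<in> {1..m} \<Longrightarrow> A_alpha_spectrum \<alpha> (H i) = image_mset (\<mu> i) (mset_set {1..q})"
    and "\<And>i. i \<in> {1..m} \<Longrightarrow> mono_on {1..q} (\<mu> i)"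
    and "\<And>i. i \<in> {1..m} \<Longrightarrow> \<mu> i q = real r\<^sub>2"
    and "\<And>j. j \<in> {1..n} \<Longrightarrow>
      b j = 2 * \<alpha> + real r\<^sub>2 + \<alpha> * real r\<^sub>1 * (real q + 1) + (1 - \<alpha>) * lam j"
    and "\<And>j. j \<in> {1..n} \<Longrightarrow>
      \<gamma> j = (b j + sqrt ((b j)\<^sup>2 -
        4 * ((2 * \<alpha> + real r\<^sub>2) * (\<alpha> * real r\<^sub>1 * (real q + 1) + (1 - \<alpha>) * lam j)
             - real q * (1 - \<alpha>)\<^sup>2 * (real r\<^sub>1 + lam j)))) / 2"
    and "\<And>j. j \<in> {1..n} \<Longrightarrow>
      \<gamma>' j = (b j - sqrt ((b j)\<^sup>2 -
        4 * ((2 * \<alpha> + real r\<^sub>2) * (\<alpha> * real r\<^sub>1 * (real q + 1) + (1 - \<alpha>) * lam j)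
             - real q * (1 - \<alpha>)\<^sup>2 * (real r\<^sub>1 + lam j)))) / 2"
  shows "A_alpha_spectrum \<alpha> (edge_corona G m e H) + replicate_mset (n - m) (2 * \<alpha> + real r\<^sub>2) =
      replicate_mset (m - n) (2 * \<alpha> + real r\<^sub>2)
      + (\<Sum>i\<in>{1..m}. \<Sum>k\<in>{1..q - 1}. {# \<mu> i k + 2 * \<alpha> #})
      + (\<Sum>j\<in>{1..n}. {# \<gamma> j, \<gamma>' j #})"
proof -
  interpret regular_edge_corona G H e m q r\<^sub>1 r\<^sub>2
    by (rule regular_edge_corona.intro) (fact assms(3,5,8,13,14,15))+
  define a where "a = 2 * \<alpha> + real r\<^sub>2"
  define c where "c j = \<alpha> * real r\<^sub>1 * (real q + 1) + (1 - \<alpha>) * lam j" for j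
  define vs where "vs = vertex_enum corona"
  define gs where "gs = vertex_enum G"
  define hs where "hs i = vertex_enum (H i)" for i
  have vs: "distinct vs" "set vs = pverts corona"
    unfolding vs_def using vertex_enum pair_graph_arcs(1)[OF pair_graph_corona] by blast+
  have gs: "distinct gs" "set gs = pverts G"
    unfolding gs_def using vertex_enum arcs_G(1) by blast+
  have hs: "distinct (hs i)" "set (hs i) = pverts (H i)" if "i \<in> {1..m}" for i
    unfolding hs_def using vertex_enum pair_graph_arcs(1)[OF pair_graph_H[OF that]] by blast+
  have len_gs: "length gs = n" using gs assms(6) distinct_card by metis
  have len_hs: "length (hs i) = q" if "i \<in> {1..m}" for i
    using hs[OF that] card_H[OF that] distinct_card by metis
  have cpG: "char_poly (adjacency_matrix G gs) = (\<Prod>j\<in>{1..n}. [:- lam j, 1:])"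
    using assms(9) len_gs unfolding adjacency_spectrum_def
    by (intro char_poly_eq_prod_eigenvalues) (auto simp: gs_def adjacency_matrix_def)
  have cpH: "char_poly (A_alpha_matrix \<alpha> (H i) (hs i)) = (\<Prod>k\<in>{1..q}. [:- \<mu> i k, 1:])"
    if i: "i \<in> {1..m}" for i
    using assms(16)[OF i] len_hs[OF i] unfolding A_alpha_spectrum_def
    by (intro char_poly_eq_prod_eigenvalues) (auto simp: hs_def A_alpha_matrix_def adjacency_matrix_def)
  have quadratic: "(t - a) * (t - c j) - real q * (1 - \<alpha>)\<^sup>2 * (real r\<^sub>1 + lam j) =
      (t - \<gamma> j) * (t - \<gamma>' j)" if j: "j \<in> {1..n}" for t j
  proof -
    define k where "k = real q * (1 - \<alpha>)\<^sup>2 * (real r\<^sub>1 + lam j)"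
    define D where "D = (b j)\<^sup>2 - 4 * (a * c j - k)"
    have bj: "b j = a + c j" using assms(19)[OF j] by (simp add: a_def c_def)
    \<comment> \<open>The factorization needs \<open>(sqrt D)\<^sup>2 = D\<close>, that is \<open>D \<ge> 0\<close>.\<close>
    have "poly (char_poly (adjacency_matrix G gs)) (lam j) = 0"
      unfolding cpG poly_prod using j by (auto intro!: prod_zero)
    then have "- real r\<^sub>1 \<le> lam j"
      by (rule adjacency_eigenvalue_ge[OF pair_graph_G regular_G gs])
    then have "k \<ge> 0" by (simp add: k_def)
    moreover have "D = (a - c j)\<^sup>2 + 4 * k"
      by (simp add: D_def bj power2_eq_square algebra_simps)
    ultimately have sq: "(sqrt D)\<^sup>2 = D" by simp
    have roots: "\<gamma> j = (b j + sqrt D) / 2" "\<gamma>' j = (b j - sqrt D) / 2"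
      using assms(20,21)[OF j] by (simp_all add: D_def k_def a_def c_def)
    have "(t - \<gamma> j) * (t - \<gamma>' j) = t\<^sup>2 - b j * t + ((b j)\<^sup>2 - (sqrt D)\<^sup>2) / 4"
      unfolding roots by (simp add: power2_eq_square field_simps)
    also have "\<dots> = (t - a) * (t - c j) - k"
      unfolding sq by (simp add: D_def bj power2_eq_square field_simps)
    finally show ?thesis by (simp add: k_def)
  qed
  let ?X = "char_poly (A_alpha_matrix \<alpha> corona vs)"
  have "?X * [:- a, 1:] ^ n = (\<Prod>j\<in>{1..n}. [:- \<gamma> j, 1:]) * (\<Prod>j\<in>{1..n}. [:- \<gamma>' j, 1:]) *
      (\<Prod>i\<in>{1..m}. \<Prod>k\<in>{1..q}. [:- (\<mu> i k + 2 * \<alpha>), 1:])" (is "_ = ?G * ?G' * ?M")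
  proof (rule poly_ext)
    fix t
    have "poly (?X * [:- a, 1:] ^ n) t =
        (\<Prod>j\<in>{1..n}. (t - a) * (t - c j) - real q * (1 - \<alpha>)\<^sup>2 * (real r\<^sub>1 + lam j)) *
        (\<Prod>i\<in>{1..m}. poly (char_poly (A_alpha_matrix \<alpha> (H i) (hs i))) (t - 2 * \<alpha>))"
      using poly_char_poly_corona[OF vs gs hs cpG, of \<alpha> t] assms(6)
      unfolding a_def[symmetric] c_def[symmetric] by simp
    also have "\<dots> = (\<Prod>j\<in>{1..n}. (t - \<gamma> j) * (t - \<gamma>' j)) *
        (\<Prod>i\<in>{1..m}. \<Prod>k\<in>{1..q}. t - 2 * \<alpha> - \<mu> i k)"
      by (intro arg_cong2[of _ _ _ _ "(*)"] prod.cong)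
        (simp_all only: quadratic cpH poly_prod, simp_all)
    also have "\<dots> = poly (?G * ?G' * ?M) t"
      unfolding poly_mult poly_prod prod.distrib by (simp add: algebra_simps)
    finally show "poly (?X * [:- a, 1:] ^ n) t = poly (?G * ?G' * ?M) t" .
  qed
  then have "proots (?X * [:- a, 1:] ^ n) = proots (?G * ?G' * ?M)" by simp
  moreover have "?X \<noteq> 0"
    using degree_monic_char_poly[of "A_alpha_matrix \<alpha> corona vs" "length vs"]
    by (auto simp: A_alpha_matrix_def adjacency_matrix_def)
  moreover have "proots ([:- a, 1:] ^ n) = replicate_mset n a"
    by (simp add: proots_power repeat_mset_replicate_mset)
  moreover have "?G \<noteq> 0" "?G' \<noteq> 0" "?M \<noteq> 0" by auto
  moreover have "proots ?M = (\<Sum>i\<in>{1..m}. \<Sum>k\<in>{1..q}. {# \<mu> i k + 2 * \<alpha> #})"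
    by (subst proots_prod) (auto simp only: proots_prod_linear, auto)
  ultimately have "A_alpha_spectrum \<alpha> corona + replicate_mset n a =
      (\<Sum>j\<in>{1..n}. {# \<gamma> j #}) + (\<Sum>j\<in>{1..n}. {# \<gamma>' j #})
      + (\<Sum>i\<in>{1..m}. \<Sum>k\<in>{1..q}. {# \<mu> i k + 2 * \<alpha> #})"
    by (simp add: A_alpha_spectrum_def eigenvalue_mset_def vs_def proots_mult proots_prod_linear)
  also have "(\<Sum>j\<in>{1..n}. {# \<gamma> j #}) + (\<Sum>j\<in>{1..n}. {# \<gamma>' j #}) = (\<Sum>j\<in>{1..n}. {# \<gamma> j, \<gamma>' j #})"
    by (simp add: sum.distrib[symmetric] add_mset_commute)
  \<comment> \<open>The factor for \<open>k = q\<close> belongs to the eigenvalue \<open>\<mu> i q = r\<^sub>2\<close> of the constant vectors.\<close>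
  also have "(\<Sum>i\<in>{1..m}. \<Sum>k\<in>{1..q}. {# \<mu> i k + 2 * \<alpha> #}) =
      (\<Sum>i\<in>{1..m}. (\<Sum>k\<in>{1..q - 1}. {# \<mu> i k + 2 * \<alpha> #}) + {# a #})"
  proof (rule sum.cong)
    fix i assume i: "i \<in> {1..m}"
    obtain p where "q = Suc p" using assms(12) by (cases q) auto
    then show "(\<Sum>k\<in>{1..q}. {# \<mu> i k + 2 * \<alpha> #}) =
        (\<Sum>k\<in>{1..q - 1}. {# \<mu> i k + 2 * \<alpha> #}) + {# a #}"
      using assms(18)[OF i] by (simp add: a_def add.commute)
  qed simp
  also have "\<dots> = (\<Sum>i\<in>{1..m}. \<Sum>k\<in>{1..q - 1}. {# \<mu> i k + 2 * \<alpha> #}) + replicate_mset m a"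
  proof -
    have "(\<Sum>i\<in>{1..p}. {# a #}) = replicate_mset p a" for p by (induction p) auto
    then show ?thesis by (simp only: sum.distrib)
  qed
  finally have "A_alpha_spectrum \<alpha> corona + replicate_mset n a =
      (\<Sum>j\<in>{1..n}. {# \<gamma> j, \<gamma>' j #})
      + (\<Sum>i\<in>{1..m}. \<Sum>k\<in>{1..q - 1}. {# \<mu> i k + 2 * \<alpha> #}) + replicate_mset m a"
    by (simp add: add.assoc)
  \<comment> \<open>Both sides contain \<open>min m n\<close> copies of \<open>a\<close>, which cancel.\<close>
  moreover have "replicate_mset n a = replicate_mset (n - m) a + replicate_mset (min m n) a"
    "replicate_mset m a = replicate_mset (m - n) a + replicate_mset (min m n) a"
    by (rule multiset_eqI; simp add: min_def)+
  ultimately show ?thesis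
    unfolding a_def[symmetric] by (simp add: ac_simps add_mset_commute)
qed

end
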